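(* Let $\mathbb{A}$ be an algebra with underlying set $A$. Let $S\subseteq\mathbb{N}$ be a finite set with at least one element, and let $G\subseteq A^{2^S}$ be a set of $|S|$-dimensional cubes labeled by elements of $A$. Let $C(G)\le\mathbb{A}$ be the subalgebra of $\mathbb{A}$ generated by the elements of $A$ that label vertices of elements of $G$. Then the following procedure produces $\Theta_S(G)$, the $|S|$-dimensional congruence of $\mathbb{A}$ generated by $G$: (1) symmetrically and reflexively close $G$, i.e. let $G_1$ be the closure of $G$ under the maps $\mathrm{Sym}_i$ and $\mathrm{Refl}_i^j$ for all $i\in S$ and $j\in 2$; (2) let $G_2$ be the closure of $G_1$ under the coordinatewise action of the operations in $\mathrm{Pol}_{|S|}(C(G))$; (3) close the resulting set with $\mathrm{TC}$, i.e. take $\mathrm{TC}(G_2)$. That is, $\mathrm{TC}(G_2)=\Theta_S(G)$.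
   Context: $2^S$ is the set of functions $S\to 2=\{0,1\}$. An element $\gamma\in A^{2^S}$ is a labeled $|S|$-dimensional cube with labels $\gamma_f$ ($f\in 2^S$); a subset of $A^{2^S}$ is an $|S|$-dimensional relation. For $i\in S$, $j\in 2$, $\gamma\in A^{2^S}$, let $\mathrm{Faces}_i^j(\gamma)\in A^{2^{S\setminus\{i\}}}$ be given by $\mathrm{Faces}_i^j(\gamma)_g=\gamma_f$ where $f$ extends $g\in 2^{S\setminus\{i\}}$ by $f_i=j$. The map $\mathrm{Faces}_i:\gamma\mapsto\langle\mathrm{Faces}_i^0(\gamma),\mathrm{Faces}_i^1(\gamma)\rangle$ is a bijection from $A^{2^S}$ to $(A^{2^{S\setminus\{i\}}})^2$; its inverse is denoted $\mathrm{Glue}_{\{i\}}$. Both are applied to sets elementwise. Define $\mathrm{Refl}_i^j(\gamma)=\mathrm{Glue}_{\{i\}}(\langle\mathrm{Faces}_i^j(\gamma),\mathrm{Faces}_i^j(\gamma)\rangle)$ and $\mathrm{Sym}_i(\gamma)=\mathrm{Glue}_{\{i\}}(\langle\mathrm{Faces}_i^1(\gamma),\mathrm{Faces}_i^0(\gamma)\rangle)$. A binary relation $R$ on a set $B$ is a quasiequivalence relation if it is quasireflexive ($\langle a,b\rangle\in R$ implies $\langle a,a\rangle,\langle b,b\rangle\in R$), symmetric and transitive. $R\subseteq A^{2^S}$ is an $|S|$-dimensional equivalence relation if $\mathrm{Faces}_i(R)$ is a quasiequivalence relation on $A^{2^{S\setminus\{i\}}}$ for every $i\in S$; it is an $|S|$-dimensional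 congruence of $\mathbb{A}$ if it is moreover closed under the basic operations of $\mathbb{A}$ applied coordinatewise. $\Theta_S(G)$ is the intersection of all $|S|$-dimensional congruences of $\mathbb{A}$ containing $G$. $\mathrm{Pol}_m(C)$ is the set of $m$-ary polynomial operations of the algebra $C$, i.e. operations obtained from term operations of $C$ by substituting constants from $C$ for some of the arguments. For $Y\subseteq A^{2^S}$ and $i\in S$, let $Y^{\circ_i}=\mathrm{Glue}_{\{i\}}(\mathrm{Faces}_i(Y)^{\circ})$, where $\mathrm{Faces}_i(Y)^\circ$ is the transitive closure of the binary relation $\mathrm{Faces}_i(Y)$. Fix an enumeration $S=\{i_0,\dots,i_{n-1}\}$, $n=|S|$. Put $\mathrm{TC}_0(Y)=Y^{\circ_{i_0}}$, $\mathrm{TC}_j(Y)=(\mathrm{TC}_{j-1}(Y))^{\circ_{i_{j \bmod n}}}$ for $j>0$, and $\mathrm{TC}(Y)=\bigcup_{j\in\mathbb{N}}\mathrm{TC}_j(Y)$.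
   Formalization: The formal theorem additionally assumes that G is nonempty or that the algebra has no nullary basic operations; if G is empty and there is a nullary operation, TC(G_2) is empty while Θ_S(G) contains a constant cube, so the claim fails. *)

theory Defs
  imports "HOL.Hull" "HOL-Library.FuncSet"
begin

section \<open>Algebras, subalgebras and polynomial operations\<close>

definition tuples :: "'a set \<Rightarrow> nat \<Rightarrow> 'a list set" where
  "tuples B m = {xs. set xs \<subseteq> B \<and> length xs = m}"

text \<open>An algebra of arbitrary finitary signature. The values of \<open>interp\<close> matter only for symbols
  in \<open>symbols\<close>, on argument lists of the right length with entries in \<open>universe\<close>.\<close>

record ('f, 'a) algebra =
  universe :: "'a set"
  symbols :: "'f set"
  arity :: "'f \<Rightarrow> nat"
  interp :: "'f \<Rightarrow> 'a list \<Rightarrow> 'a"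

definition subuniverse :: "('f, 'a) algebra \<Rightarrow> 'a set \<Rightarrow> bool" where
  "subuniverse \<AA> B \<longleftrightarrow> B \<subseteq> universe \<AA> \<and>
     (\<forall>F\<in>symbols \<AA>. \<forall>xs\<in>tuples B (arity \<AA> F). interp \<AA> F xs \<in> B)"

definition is_algebra :: "('f, 'a) algebra \<Rightarrow> bool" where
  "is_algebra \<AA> \<longleftrightarrow>
     (\<forall>F\<in>symbols \<AA>. \<forall>xs\<in>tuples (universe \<AA>) (arity \<AA> F). interp \<AA> F xs \<in> universe \<AA>)"

definition generated_subalgebra :: "('f, 'a) algebra \<Rightarrow> 'a set \<Rightarrow> ('f, 'a) algebra" where
  "generated_subalgebra \<AA> X = \<AA>\<lparr>universe := subuniverse \<AA> hull X\<rparr>"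

datatype 'f trm = Var nat | App 'f "'f trm list"

fun wf_trm :: "('f, 'a) algebra \<Rightarrow> nat \<Rightarrow> 'f trm \<Rightarrow> bool" where
  "wf_trm \<AA> m (Var i) \<longleftrightarrow> i < m"
| "wf_trm \<AA> m (App F ts) \<longleftrightarrow>
     F \<in> symbols \<AA> \<and> length ts = arity \<AA> F \<and> (\<forall>t\<in>set ts. wf_trm \<AA> m t)"

fun eval_trm :: "('f, 'a) algebra \<Rightarrow> 'f trm \<Rightarrow> 'a list \<Rightarrow> 'a" where
  "eval_trm \<AA> (Var i) xs = xs ! i"
| "eval_trm \<AA> (App F ts) xs = interp \<AA> F (map (\<lambda>t. eval_trm \<AA> t xs) ts)"

definition term_ops :: "('f, 'a) algebra \<Rightarrow> nat \<Rightarrow> ('a list \<Rightarrow> 'a) set" where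
  "term_ops \<AA> m = {\<lambda>xs\<in>tuples (universe \<AA>) m. eval_trm \<AA> t xs | t. wf_trm \<AA> m t}"

text \<open>Since term operations may be permuted in their arguments, it is no restriction to let the
  constants occupy the last \<open>k\<close> places.\<close>

definition Pol :: "nat \<Rightarrow> ('f, 'a) algebra \<Rightarrow> ('a list \<Rightarrow> 'a) set" where
  "Pol m \<AA> = {\<lambda>xs\<in>tuples (universe \<AA>) m. t (xs @ cs) | t k cs.
     t \<in> term_ops \<AA> (m + k) \<and> cs \<in> tuples (universe \<AA>) k}"

section \<open>Cubes, faces and gluing\<close>

text \<open>\<open>bin S\<close> is the set of functions from \<open>S\<close> to \<open>{0, 1}\<close>; such functions, and likewise the cubes,
  are extensional, i.e. equal to \<^term>\<open>undefined\<close> outside of their domain.\<close>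

definition bin :: "nat set \<Rightarrow> (nat \<Rightarrow> nat) set" where
  "bin S = S \<rightarrow>\<^sub>E {0, 1}"

type_synonym 'a cube = "(nat \<Rightarrow> nat) \<Rightarrow> 'a"

definition cubes :: "'a set \<Rightarrow> nat set \<Rightarrow> 'a cube set" where
  "cubes A S = bin S \<rightarrow>\<^sub>E A"

definition face :: "nat set \<Rightarrow> nat \<Rightarrow> nat \<Rightarrow> 'a cube \<Rightarrow> 'a cube" where
  "face S i j \<gamma> = (\<lambda>g\<in>bin (S - {i}). \<gamma> (g(i := j)))"

definition faces :: "nat set \<Rightarrow> nat \<Rightarrow> 'a cube \<Rightarrow> 'a cube \<times> 'a cube" where
  "faces S i \<gamma> = (face S i 0 \<gamma>, face S i 1 \<gamma>)"

definition glue :: "nat set \<Rightarrow> nat \<Rightarrow> 'a cube \<times> 'a cube \<Rightarrow> 'a cube" where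
  "glue S i p = (\<lambda>f\<in>bin S. (if f i = 0 then fst p else snd p) (restrict f (S - {i})))"

lemma bin_upd: "i \<in> S \<Longrightarrow> g \<in> bin (S - {i}) \<Longrightarrow> j \<in> {0, 1} \<Longrightarrow> g(i := j) \<in> bin S"
  by (simp add: bin_def PiE_iff extensional_def)

lemma bin_restrict: "f \<in> bin S \<Longrightarrow> restrict f (S - {i}) \<in> bin (S - {i})"
  by (simp add: bin_def PiE_iff)

lemma face_in_cubes:
  assumes "i \<in> S" "j \<in> {0, 1}" "\<gamma> \<in> cubes A S"
  shows "face S i j \<gamma> \<in> cubes A (S - {i})"
  using assms bin_upd[OF assms(1) _ assms(2)] unfolding cubes_def face_def
  by (auto simp: PiE_iff)

lemma glue_in_cubes:
  assumes "p \<in> cubes A (S - {i}) \<times> cubes A (S - {i})"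
  shows "glue S i p \<in> cubes A S"
  using assms bin_restrict[of _ S i] unfolding cubes_def glue_def
  by (auto simp: PiE_iff)

lemma glue_faces:
  assumes "i \<in> S" "\<gamma> \<in> cubes A S"
  shows "glue S i (faces S i \<gamma>) = \<gamma>"
proof
  fix f
  show "glue S i (faces S i \<gamma>) f = \<gamma> f"
  proof (cases "f \<in> bin S")
    case True
    then have upd: "(restrict f (S - {i}))(i := f i) = f" and fi: "f i = 0 \<or> f i = 1"
      using \<open>i \<in> S\<close> by (auto simp: bin_def PiE_iff extensional_def fun_eq_iff)
    have "glue S i (faces S i \<gamma>) f = face S i (f i) \<gamma> (restrict f (S - {i}))"
      using True fi by (auto simp: glue_def faces_def)
    also have "\<dots> = \<gamma> ((restrict f (S - {i}))(i := f i))"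
      unfolding face_def by (rule restrict_apply'[OF bin_restrict[OF True]])
    finally show ?thesis
      unfolding upd .
  next
    case False
    then show ?thesis
      using assms(2) by (auto simp: glue_def cubes_def PiE_iff extensional_def)
  qed
qed

lemma faces_glue:
  assumes "i \<in> S" "p \<in> cubes A (S - {i}) \<times> cubes A (S - {i})"
  shows "faces S i (glue S i p) = p"
proof -
  have *: "restrict g (S - {i}) = g" if "g \<in> bin (S - {i})" for g
    using that by (auto simp: bin_def PiE_iff extensional_def fun_eq_iff)
  have "face S i j (glue S i p) = (if j = 0 then fst p else snd p)" if "j \<in> {0, 1}" for j
  proof
    fix g
    show "face S i j (glue S i p) g = (if j = 0 then fst p else snd p) g"
    proof (cases "g \<in> bin (S - {i})")
      case True
      then show ?thesis
        using bin_upd[OF \<open>i \<in> S\<close> True that] by (simp add: face_def glue_def *)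
    next
      case False
      then show ?thesis
        using assms(2) by (auto simp: face_def cubes_def PiE_iff extensional_def)
    qed
  qed
  from this[of 0] this[of 1] show ?thesis
    by (simp add: faces_def)
qed

lemma faces_bij_betw:
  assumes "i \<in> S"
  shows "bij_betw (faces S i) (cubes A S) (cubes A (S - {i}) \<times> cubes A (S - {i}))"
proof (rule bij_betw_byWitness[where f' = "glue S i"])
  show "\<forall>\<gamma>\<in>cubes A S. glue S i (faces S i \<gamma>) = \<gamma>"
    using glue_faces[OF assms] by blast
  show "\<forall>p\<in>cubes A (S - {i}) \<times> cubes A (S - {i}). faces S i (glue S i p) = p"
    using faces_glue[OF assms] by blast
  show "faces S i ` cubes A S \<subseteq> cubes A (S - {i}) \<times> cubes A (S - {i})"
    using face_in_cubes[OF assms] by (auto simp: faces_def)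
  show "glue S i ` (cubes A (S - {i}) \<times> cubes A (S - {i})) \<subseteq> cubes A S"
    using glue_in_cubes by blast
qed

definition refl_cube :: "nat set \<Rightarrow> nat \<Rightarrow> nat \<Rightarrow> 'a cube \<Rightarrow> 'a cube" where
  "refl_cube S i j \<gamma> = glue S i (face S i j \<gamma>, face S i j \<gamma>)"

definition sym_cube :: "nat set \<Rightarrow> nat \<Rightarrow> 'a cube \<Rightarrow> 'a cube" where
  "sym_cube S i \<gamma> = glue S i (face S i 1 \<gamma>, face S i 0 \<gamma>)"

section \<open>Higher dimensional congruences\<close>

definition quasireflexive :: "('b \<times> 'b) set \<Rightarrow> bool" where
  "quasireflexive R \<longleftrightarrow> (\<forall>(a, b)\<in>R. (a, a) \<in> R \<and> (b, b) \<in> R)"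

definition quasiequiv :: "'b set \<Rightarrow> ('b \<times> 'b) set \<Rightarrow> bool" where
  "quasiequiv B R \<longleftrightarrow> R \<subseteq> B \<times> B \<and> quasireflexive R \<and> sym R \<and> trans R"

definition dim_equivalence :: "'a set \<Rightarrow> nat set \<Rightarrow> 'a cube set \<Rightarrow> bool" where
  "dim_equivalence A S R \<longleftrightarrow>
     R \<subseteq> cubes A S \<and> (\<forall>i\<in>S. quasiequiv (cubes A (S - {i})) (faces S i ` R))"

definition coordinatewise :: "nat set \<Rightarrow> ('a list \<Rightarrow> 'a) \<Rightarrow> 'a cube list \<Rightarrow> 'a cube" where
  "coordinatewise S p \<gamma>s = (\<lambda>f\<in>bin S. p (map (\<lambda>\<gamma>. \<gamma> f) \<gamma>s))"

definition closed_under :: "nat set \<Rightarrow> nat \<Rightarrow> ('a list \<Rightarrow> 'a) \<Rightarrow> 'a cube set \<Rightarrow> bool" where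
  "closed_under S m p R \<longleftrightarrow> (\<forall>\<gamma>s\<in>tuples R m. coordinatewise S p \<gamma>s \<in> R)"

definition dim_congruence :: "('f, 'a) algebra \<Rightarrow> nat set \<Rightarrow> 'a cube set \<Rightarrow> bool" where
  "dim_congruence \<AA> S R \<longleftrightarrow> dim_equivalence (universe \<AA>) S R \<and>
     (\<forall>F\<in>symbols \<AA>. closed_under S (arity \<AA> F) (interp \<AA> F) R)"

definition Theta :: "('f, 'a) algebra \<Rightarrow> nat set \<Rightarrow> 'a cube set \<Rightarrow> 'a cube set" where
  "Theta \<AA> S G = dim_congruence \<AA> S hull G"

text \<open>The set of all cubes is a congruence, so \<open>Theta\<close> is an intersection of a nonempty family.\<close>

lemma dim_congruence_cubes:
  assumes "is_algebra \<AA>"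
  shows "dim_congruence \<AA> S (cubes (universe \<AA>) S)"
proof -
  let ?A = "universe \<AA>"
  have "quasiequiv (cubes ?A (S - {i})) (faces S i ` cubes ?A S)" if "i \<in> S" for i
    unfolding bij_betw_imp_surj_on[OF faces_bij_betw[OF that]]
    by (simp add: quasiequiv_def quasireflexive_def sym_def trans_def)
  moreover have "closed_under S (arity \<AA> F) (interp \<AA> F) (cubes ?A S)" if "F \<in> symbols \<AA>" for F
  proof -
    have "map (\<lambda>\<gamma>. \<gamma> f) \<gamma>s \<in> tuples ?A (arity \<AA> F)"
      if "f \<in> bin S" "\<gamma>s \<in> tuples (cubes ?A S) (arity \<AA> F)" for f \<gamma>s
      using that by (auto simp: tuples_def cubes_def)
    then have "coordinatewise S (interp \<AA> F) \<gamma>s \<in> cubes ?A S"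
      if "\<gamma>s \<in> tuples (cubes ?A S) (arity \<AA> F)" for \<gamma>s
      using assms \<open>F \<in> symbols \<AA>\<close> that
      unfolding coordinatewise_def is_algebra_def cubes_def[of ?A] by (simp add: restrict_PiE_iff)
    then show ?thesis
      by (simp add: closed_under_def)
  qed
  ultimately show ?thesis
    by (simp add: dim_congruence_def dim_equivalence_def)
qed

section \<open>The generation procedure\<close>

definition cube_labels :: "nat set \<Rightarrow> 'a cube set \<Rightarrow> 'a set" where
  "cube_labels S G = {\<gamma> f | \<gamma> f. \<gamma> \<in> G \<and> f \<in> bin S}"

definition sym_refl_closure :: "nat set \<Rightarrow> 'a cube set \<Rightarrow> 'a cube set" where
  "sym_refl_closure S G =
     (\<lambda>R. \<forall>\<gamma>\<in>R. \<forall>i\<in>S. sym_cube S i \<gamma> \<in> R \<and> (\<forall>j\<in>{0, 1}. refl_cube S i j \<gamma> \<in> R)) hull G"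

definition pol_closure :: "nat set \<Rightarrow> nat \<Rightarrow> ('f, 'a) algebra \<Rightarrow> 'a cube set \<Rightarrow> 'a cube set" where
  "pol_closure S m \<CC> G = (\<lambda>R. \<forall>p\<in>Pol m \<CC>. closed_under S m p R) hull G"

definition trans_closure :: "nat set \<Rightarrow> nat \<Rightarrow> 'a cube set \<Rightarrow> 'a cube set" where
  "trans_closure S i Y = glue S i ` ((faces S i ` Y)\<^sup>+)"

text \<open>Here \<open>e\<close> enumerates \<open>S\<close> as \<open>e 0, \<dots>, e (card S - 1)\<close>.\<close>

primrec TC_step :: "nat set \<Rightarrow> (nat \<Rightarrow> nat) \<Rightarrow> nat \<Rightarrow> 'a cube set \<Rightarrow> 'a cube set" where
  "TC_step S e 0 Y = trans_closure S (e 0) Y"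
| "TC_step S e (Suc j) Y = trans_closure S (e (Suc j mod card S)) (TC_step S e j Y)"

definition TC :: "nat set \<Rightarrow> (nat \<Rightarrow> nat) \<Rightarrow> 'a cube set \<Rightarrow> 'a cube set" where
  "TC S e Y = (\<Union>j. TC_step S e j Y)"

end

theory Submission
  imports Defs
begin

text \<open>
  Read transitivity geometrically: if two cubes share a face orthogonal to direction \<open>i\<close>, they can
  be pasted along it. A set of cubes is a higher dimensional equivalence relation exactly if it is
  closed under symmetries, degeneracies and pasting (\<open>dim_equivalence_iff\<close>), and \<open>TC\<close> of \<open>G2\<close> is
  the set \<open>T\<close> of all \<^emph>\<open>composites\<close> of \<open>G2\<close>, the closure of \<open>G2\<close> under pasting
  (\<open>TC_eq_composites\<close>): the stages of \<open>TC\<close> increase and every direction recurs, so that any two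
  abutting cubes are pasted at some later stage.

  One inclusion says that every congruence \<open>R\<close> containing \<open>G\<close> contains \<open>T\<close>. The cubes of \<open>R\<close> with
  labels in \<open>C(G)\<close> form a set that is closed under pasting and under the operations, and that
  contains every constant cube over \<open>C(G)\<close>: degenerating a generator in all directions produces the
  constant cube at any of its vertices. Hence that set absorbs the polynomial operations as well.

  The other inclusion says that \<open>T\<close> is a congruence, and what needs an idea is closure under a basic
  operation \<open>F\<close> of arbitrary arity, although \<open>G2\<close> is only closed under polynomials in \<open>n = |S|\<close>
  variables. There are two steps.

  \<^item> If a set is closed under an operation, so are its composites (\<open>closed_under_composites\<close>). A
    pasting in one argument is pulled out of the operation by degenerating all other arguments
    in the direction of pasting on one of the two sides.

  \<^item> \<open>F(\<gamma>\<^sub>1, \<dots>, \<gamma>\<^sub>k)\<close> is a grid of cells in which at most one argument varies in each direction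
    (\<open>closed_under_if_closed_on_cells\<close>): crossing the cube in direction \<open>i\<close>, move the arguments one
    after the other instead of simultaneously. With \<open>n\<close> directions, at most \<open>n\<close> of the arguments of
    a cell are not constant cubes, so that the cell is the value of an \<open>n\<close>-ary polynomial of \<open>C(G)\<close>
    (\<open>coordinatewise_cell\<close>).

  The number \<open>|S|\<close> of variables in the procedure is explained by the second step. If \<open>G\<close> is empty, so
  is \<open>C(G)\<close>, because then \<open>\<AA>\<close> has no nullary symbols; otherwise all constant cubes over \<open>C(G)\<close> are
  values of constant polynomials.
\<close>

section \<open>Symmetries, degeneracies and pasting of cubes\<close>

text \<open>Degeneracies and symmetries are both substitutions on vertices, which is why they commute
  with every coordinatewise operation.\<close>

definition reindex :: "nat set \<Rightarrow> ((nat \<Rightarrow> nat) \<Rightarrow> nat \<Rightarrow> nat) \<Rightarrow> 'a cube \<Rightarrow> 'a cube" where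
  "reindex S \<phi> \<gamma> = (\<lambda>f\<in>bin S. \<gamma> (\<phi> f))"

definition const_cube :: "nat set \<Rightarrow> 'a \<Rightarrow> 'a cube" where
  "const_cube S c = (\<lambda>f\<in>bin S. c)"

text \<open>The value \<open>f i\<close> is overwritten on both sides, so \<open>f\<close> may range over all vertices of the cube
  instead of those of a face.\<close>

definition abut :: "nat set \<Rightarrow> nat \<Rightarrow> 'a cube \<Rightarrow> 'a cube \<Rightarrow> bool" where
  "abut S i \<gamma> \<delta> \<longleftrightarrow> (\<forall>f\<in>bin S. \<gamma> (f(i := 1)) = \<delta> (f(i := 0)))"

definition paste :: "nat \<Rightarrow> 'a cube \<Rightarrow> 'a cube \<Rightarrow> 'a cube" where
  "paste i \<gamma> \<delta> = (\<lambda>f. if f i = 0 then \<gamma> f else \<delta> f)"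

text \<open>The cubes fixed by the degeneracies in direction \<open>i\<close>.\<close>

definition degenerate :: "nat set \<Rightarrow> nat \<Rightarrow> 'a cube \<Rightarrow> bool" where
  "degenerate S i \<gamma> \<longleftrightarrow> (\<forall>f\<in>bin S. \<forall>j\<in>{0, 1}. \<gamma> (f(i := j)) = \<gamma> f)"

definition sym_refl_closed :: "nat set \<Rightarrow> 'a cube set \<Rightarrow> bool" where
  "sym_refl_closed S R \<longleftrightarrow>
     (\<forall>\<gamma>\<in>R. \<forall>i\<in>S. sym_cube S i \<gamma> \<in> R \<and> (\<forall>j\<in>{0, 1}. refl_cube S i j \<gamma> \<in> R))"

definition paste_closed :: "nat set \<Rightarrow> 'a cube set \<Rightarrow> bool" where
  "paste_closed S R \<longleftrightarrow> (\<forall>\<gamma>\<in>R. \<forall>\<delta>\<in>R. \<forall>i\<in>S. abut S i \<gamma> \<delta> \<longrightarrow> paste i \<gamma> \<delta> \<in> R)"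

lemma paste_closedD:
  "paste_closed S R \<Longrightarrow> \<gamma> \<in> R \<Longrightarrow> \<delta> \<in> R \<Longrightarrow> i \<in> S \<Longrightarrow> abut S i \<gamma> \<delta> \<Longrightarrow> paste i \<gamma> \<delta> \<in> R"
  by (simp add: paste_closed_def)

lemma bin_update: "i \<in> S \<Longrightarrow> f \<in> bin S \<Longrightarrow> j \<in> {0, 1} \<Longrightarrow> f(i := j) \<in> bin S"
  by (auto simp: bin_def PiE_iff extensional_def)

lemma bin_cases: "i \<in> S \<Longrightarrow> f \<in> bin S \<Longrightarrow> f i = 0 \<or> f i = 1"
  by (auto simp: bin_def PiE_iff)

lemma bin_restrict_update:
  assumes "i \<in> S" "f \<in> bin S"
  shows "restrict f (insert i S) = f" "restrict (f(i := j)) (insert i S) = f(i := j)"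
  using assms by (auto simp: bin_def PiE_iff extensional_def fun_eq_iff)

lemma cube_undefined: "\<gamma> \<in> cubes A S \<Longrightarrow> f \<notin> bin S \<Longrightarrow> \<gamma> f = undefined"
  by (auto simp: cubes_def PiE_iff extensional_def)

lemma cube_label: "\<gamma> \<in> cubes A S \<Longrightarrow> f \<in> bin S \<Longrightarrow> \<gamma> f \<in> A"
  by (auto simp: cubes_def PiE_iff)

lemma cubes_mono: "A \<subseteq> B \<Longrightarrow> cubes A S \<subseteq> cubes B S"
  by (auto simp: cubes_def PiE_iff)

lemma reindex_in_cubes:
  assumes "\<gamma> \<in> cubes A S" "\<And>f. f \<in> bin S \<Longrightarrow> \<phi> f \<in> bin S"
  shows "reindex S \<phi> \<gamma> \<in> cubes A S"
  using assms by (auto simp: reindex_def cubes_def PiE_iff)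

lemma refl_cube_eq: "i \<in> S \<Longrightarrow> refl_cube S i j \<gamma> = reindex S (\<lambda>f. f(i := j)) \<gamma>"
  by (auto simp: refl_cube_def reindex_def glue_def face_def fun_eq_iff bin_restrict
      bin_restrict_update)

lemma sym_cube_eq: "i \<in> S \<Longrightarrow> sym_cube S i \<gamma> = reindex S (\<lambda>f. f(i := 1 - f i)) \<gamma>"
  using bin_cases[of i S]
  by (auto simp: sym_cube_def reindex_def glue_def face_def fun_eq_iff bin_restrict
      bin_restrict_update)

lemma flip_in_bin: "i \<in> S \<Longrightarrow> f \<in> bin S \<Longrightarrow> f(i := 1 - f i) \<in> bin S"
  using bin_cases[of i S f] by (auto intro!: bin_update)

lemma sym_refl_closed_cubes: "sym_refl_closed S (cubes A S)"
  by (auto simp: sym_refl_closed_def refl_cube_eq sym_cube_eq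
      intro!: reindex_in_cubes bin_update flip_in_bin)

lemma paste_in_cubes: "\<gamma> \<in> cubes A S \<Longrightarrow> \<delta> \<in> cubes A S \<Longrightarrow> paste i \<gamma> \<delta> \<in> cubes A S"
  by (auto simp: paste_def cubes_def PiE_iff extensional_def)

lemma paste_eq_glue:
  assumes "i \<in> S" "\<gamma> \<in> cubes A S" "\<delta> \<in> cubes A S"
  shows "paste i \<gamma> \<delta> = glue S i (face S i 0 \<gamma>, face S i 1 \<delta>)"
proof
  fix f
  show "paste i \<gamma> \<delta> f = glue S i (face S i 0 \<gamma>, face S i 1 \<delta>) f"
  proof (cases "f \<in> bin S")
    case True
    then show ?thesis
      using assms(1) bin_cases[OF assms(1) True]
      by (auto simp: paste_def glue_def face_def bin_restrict bin_restrict_update fun_upd_idem)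
  next
    case False
    then show ?thesis
      using assms by (simp add: paste_def glue_def cube_undefined)
  qed
qed

lemma abut_iff_faces_eq:
  assumes "i \<in> S"
  shows "abut S i \<gamma> \<delta> \<longleftrightarrow> face S i 1 \<gamma> = face S i 0 \<delta>"
proof
  assume a: "abut S i \<gamma> \<delta>"
  show "face S i 1 \<gamma> = face S i 0 \<delta>"
  proof
    fix g
    have "\<gamma> (g(i := 1)) = \<delta> (g(i := 0))" if "g \<in> bin (S - {i})"
      using a bin_upd[OF assms that, of 0] unfolding abut_def by force
    then show "face S i 1 \<gamma> g = face S i 0 \<delta> g"
      by (simp add: face_def)
  qed
next
  assume eq: "face S i 1 \<gamma> = face S i 0 \<delta>"
  show "abut S i \<gamma> \<delta>"
    unfolding abut_def
  proof
    fix f assume f: "f \<in> bin S"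
    show "\<gamma> (f(i := 1)) = \<delta> (f(i := 0))"
      using fun_cong[OF eq, of "restrict f (S - {i})"] f assms
      by (simp add: face_def bin_restrict bin_restrict_update)
  qed
qed

lemma mem_faces_iff:
  assumes "i \<in> S" "R \<subseteq> cubes A S" "p \<in> cubes A (S - {i}) \<times> cubes A (S - {i})"
  shows "p \<in> faces S i ` R \<longleftrightarrow> glue S i p \<in> R"
proof
  assume "p \<in> faces S i ` R"
  then obtain \<gamma> where "\<gamma> \<in> R" "p = faces S i \<gamma>"
    by blast
  then show "glue S i p \<in> R"
    using glue_faces[OF assms(1), of \<gamma> A] assms(2) by auto
next
  assume "glue S i p \<in> R"
  then have "faces S i (glue S i p) \<in> faces S i ` R"
    by (rule imageI)
  then show "p \<in> faces S i ` R"
    by (simp only: faces_glue[OF assms(1,3)])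
qed

text \<open>For each single direction, quasireflexivity, symmetry and transitivity of the relation of faces
  translate into closure under degeneracies, symmetry and pasting, since gluing inverts taking
  faces.\<close>

lemma dim_equivalence_iff:
  "dim_equivalence A S R \<longleftrightarrow> R \<subseteq> cubes A S \<and> sym_refl_closed S R \<and> paste_closed S R"
proof (cases "R \<subseteq> cubes A S")
  case True
  have "quasiequiv (cubes A (S - {i})) (faces S i ` R) \<longleftrightarrow>
    (\<forall>\<gamma>\<in>R. sym_cube S i \<gamma> \<in> R \<and> (\<forall>j\<in>{0, 1}. refl_cube S i j \<gamma> \<in> R)) \<and>
    (\<forall>\<gamma>\<in>R. \<forall>\<delta>\<in>R. abut S i \<gamma> \<delta> \<longrightarrow> paste i \<gamma> \<delta> \<in> R)"
    if i: "i \<in> S" for i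
  proof -
    have face: "face S i j \<gamma> \<in> cubes A (S - {i})" if "\<gamma> \<in> R" "j \<in> {0, 1}" for \<gamma> j
      using face_in_cubes[OF i that(2) subsetD[OF True that(1)]] .
    have mem: "(face S i j \<gamma>, face S i k \<delta>) \<in> faces S i ` R
        \<longleftrightarrow> glue S i (face S i j \<gamma>, face S i k \<delta>) \<in> R"
      if "\<gamma> \<in> R" "\<delta> \<in> R" "j \<in> {0, 1}" "k \<in> {0, 1}" for \<gamma> \<delta> j k
      using mem_faces_iff[OF i True] face[OF that(1,3)] face[OF that(2,4)] by simp
    have pairs: "(\<forall>p\<in>faces S i ` R. P p) \<longleftrightarrow> (\<forall>\<gamma>\<in>R. P (face S i 0 \<gamma>, face S i 1 \<gamma>))" for P
      by (simp add: faces_def)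
    have sub: "faces S i ` R \<subseteq> cubes A (S - {i}) \<times> cubes A (S - {i})"
      using face by (auto simp: faces_def)
    have q_refl: "quasireflexive (faces S i ` R) \<longleftrightarrow> (\<forall>\<gamma>\<in>R. \<forall>j\<in>{0, 1}. refl_cube S i j \<gamma> \<in> R)"
      unfolding quasireflexive_def pairs by (auto simp: mem refl_cube_def)
    have q_sym: "sym (faces S i ` R) \<longleftrightarrow> (\<forall>\<gamma>\<in>R. sym_cube S i \<gamma> \<in> R)"
    proof -
      have "sym (faces S i ` R) \<longleftrightarrow> (\<forall>(a, b)\<in>faces S i ` R. (b, a) \<in> faces S i ` R)"
        unfolding sym_def by blast
      then show ?thesis
        unfolding pairs by (auto simp: mem sym_cube_def)
    qed
    have q_trans: "trans (faces S i ` R) \<longleftrightarrow>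
        (\<forall>\<gamma>\<in>R. \<forall>\<delta>\<in>R. abut S i \<gamma> \<delta> \<longrightarrow> paste i \<gamma> \<delta> \<in> R)"
    proof -
      have "trans Q \<longleftrightarrow> (\<forall>p\<in>Q. \<forall>q\<in>Q. snd p = fst q \<longrightarrow> (fst p, snd q) \<in> Q)"
        for Q :: "('a cube \<times> 'a cube) set"
        unfolding trans_def by force
      then have "trans (faces S i ` R) \<longleftrightarrow> (\<forall>p\<in>faces S i ` R. \<forall>q\<in>faces S i ` R.
          snd p = fst q \<longrightarrow> (fst p, snd q) \<in> faces S i ` R)" .
      also have "\<dots> \<longleftrightarrow> (\<forall>\<gamma>\<in>R. \<forall>\<delta>\<in>R. abut S i \<gamma> \<delta> \<longrightarrow> paste i \<gamma> \<delta> \<in> R)"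
        unfolding pairs fst_conv snd_conv
      proof (intro ball_cong refl)
        fix \<gamma> \<delta> assume R: "\<gamma> \<in> R" "\<delta> \<in> R"
        have "paste i \<gamma> \<delta> = glue S i (face S i 0 \<gamma>, face S i 1 \<delta>)"
          using R True by (intro paste_eq_glue[OF i, of _ A]) auto
        then show "(face S i 1 \<gamma> = face S i 0 \<delta> \<longrightarrow> (face S i 0 \<gamma>, face S i 1 \<delta>) \<in> faces S i ` R)
            = (abut S i \<gamma> \<delta> \<longrightarrow> paste i \<gamma> \<delta> \<in> R)"
          using mem[OF R] by (simp only: abut_iff_faces_eq[OF i]) simp
      qed
      finally show ?thesis .
    qed
    show ?thesis
      unfolding quasiequiv_def q_refl q_sym q_trans using sub by blast
  qed
  then have "(\<forall>i\<in>S. quasiequiv (cubes A (S - {i})) (faces S i ` R)) \<longleftrightarrow>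
    (\<forall>i\<in>S. (\<forall>\<gamma>\<in>R. sym_cube S i \<gamma> \<in> R \<and> (\<forall>j\<in>{0, 1}. refl_cube S i j \<gamma> \<in> R)) \<and>
      (\<forall>\<gamma>\<in>R. \<forall>\<delta>\<in>R. abut S i \<gamma> \<delta> \<longrightarrow> paste i \<gamma> \<delta> \<in> R))"
    by (intro ball_cong HOL.refl)
  also have "\<dots> \<longleftrightarrow> sym_refl_closed S R \<and> paste_closed S R"
    unfolding sym_refl_closed_def paste_closed_def by auto
  finally show ?thesis
    using True by (simp add: dim_equivalence_def)
qed (simp add: dim_equivalence_def)

lemma sym_refl_closed_reflD:
  "sym_refl_closed S R \<Longrightarrow> \<gamma> \<in> R \<Longrightarrow> i \<in> S \<Longrightarrow> j \<in> {0, 1} \<Longrightarrow> reindex S (\<lambda>f. f(i := j)) \<gamma> \<in> R"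
  by (subst refl_cube_eq[symmetric]) (auto simp: sym_refl_closed_def)

lemma sym_refl_closed_symD:
  "sym_refl_closed S R \<Longrightarrow> \<gamma> \<in> R \<Longrightarrow> i \<in> S \<Longrightarrow> reindex S (\<lambda>f. f(i := 1 - f i)) \<gamma> \<in> R"
  by (subst sym_cube_eq[symmetric]) (simp_all add: sym_refl_closed_def)

lemma override_on_in_bin: "f \<in> bin S \<Longrightarrow> g \<in> bin S \<Longrightarrow> override_on g f D \<in> bin S"
  by (auto simp: bin_def PiE_iff override_on_def extensional_def)

text \<open>Degenerating in direction \<open>i\<close> towards \<open>f i\<close>, for one direction after the other, collapses the
  whole cube to its vertex \<open>f\<close>.\<close>

lemma const_cube_of_label:
  assumes "finite S" "sym_refl_closed S R" "\<gamma> \<in> R" "R \<subseteq> cubes A S" "f \<in> bin S"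
  shows "const_cube S (\<gamma> f) \<in> R"
proof -
  have "finite D \<Longrightarrow> D \<subseteq> S \<Longrightarrow> reindex S (\<lambda>g. override_on g f D) \<gamma> \<in> R" for D
  proof (induction D rule: finite_induct)
    case empty
    have "reindex S (\<lambda>g. override_on g f {}) \<gamma> = \<gamma>"
      using assms(3,4) by (auto simp: reindex_def fun_eq_iff cube_undefined subset_iff)
    then show ?case
      using assms(3) by simp
  next
    case (insert i D)
    then have i: "i \<in> S" "f i \<in> {0, 1}"
      using assms(5) bin_cases by auto
    have "override_on g f (insert i D) = override_on (g(i := f i)) f D" for g
      by (auto simp: override_on_def fun_eq_iff)
    then have "reindex S (\<lambda>g. override_on g f (insert i D)) \<gamma>
        = reindex S (\<lambda>g. g(i := f i)) (reindex S (\<lambda>g. override_on g f D) \<gamma>)"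
      using bin_update[OF i(1) _ i(2)] by (auto simp: reindex_def intro!: restrict_ext)
    then show ?case
      using insert sym_refl_closed_reflD[OF assms(2) _ i] by simp
  qed
  from this[OF assms(1)] have "reindex S (\<lambda>g. override_on g f S) \<gamma> \<in> R"
    by simp
  moreover have "override_on g f S = f" if "g \<in> bin S" for g
    using that assms(5) by (auto simp: override_on_def bin_def PiE_iff extensional_def fun_eq_iff)
  ultimately show ?thesis
    by (simp add: reindex_def const_cube_def cong: restrict_cong)
qed

text \<open>Walk from the vertex \<open>g\<close> to \<open>f\<close> by changing one coordinate at a time.\<close>

lemma totally_degenerate_label:
  assumes "finite S" "\<And>i. i \<in> S \<Longrightarrow> degenerate S i \<gamma>" "f \<in> bin S" "g \<in> bin S"
  shows "\<gamma> g = \<gamma> f"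
proof -
  have "finite D \<Longrightarrow> D \<subseteq> S \<Longrightarrow> \<gamma> (override_on g f D) = \<gamma> g" for D
  proof (induction D rule: finite_induct)
    case (insert i D)
    then have i: "i \<in> S" "f i \<in> {0, 1}"
      using assms(3) bin_cases by auto
    have "override_on g f (insert i D) = (override_on g f D)(i := f i)"
      by (auto simp: override_on_def fun_eq_iff)
    moreover have "\<gamma> ((override_on g f D)(i := f i)) = \<gamma> (override_on g f D)"
      using assms(2)[OF i(1)] i(2) override_on_in_bin[OF assms(3,4), of D]
      unfolding degenerate_def by blast
    moreover have "\<gamma> (override_on g f D) = \<gamma> g"
      using insert by simp
    ultimately show ?case
      by (simp only:)
  qed simp
  from this[OF assms(1)] have "\<gamma> (override_on g f S) = \<gamma> g"
    by simp
  moreover have "override_on g f S = f"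
    using assms(3,4) by (auto simp: override_on_def bin_def PiE_iff extensional_def fun_eq_iff)
  ultimately show ?thesis
    by simp
qed

lemma degenerate_reindex_same: "i \<in> S \<Longrightarrow> j \<in> {0, 1} \<Longrightarrow> degenerate S i (reindex S (\<lambda>f. f(i := j)) \<gamma>)"
  using bin_update[of i S] by (auto simp: degenerate_def reindex_def)

lemma degenerate_reindex:
  assumes "i \<in> S" "j \<in> {0, 1}" "i' \<in> S" "degenerate S i' \<gamma>"
  shows "degenerate S i' (reindex S (\<lambda>f. f(i := j)) \<gamma>)"
proof (cases "i' = i")
  case False
  show ?thesis
    unfolding degenerate_def
  proof (intro ballI)
    fix f and a :: nat assume f: "f \<in> bin S" and a: "a \<in> {0, 1}"
    have "\<gamma> (f(i := j, i' := a)) = \<gamma> (f(i := j))"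
      using assms(4) bin_update[OF assms(1) f assms(2)] a unfolding degenerate_def by blast
    then show "reindex S (\<lambda>f. f(i := j)) \<gamma> (f(i' := a)) = reindex S (\<lambda>f. f(i := j)) \<gamma> f"
      using f bin_update[OF assms(3) f a] by (simp add: reindex_def fun_upd_twist[OF False])
  qed
qed (use assms degenerate_reindex_same in blast)

section \<open>Iterated transitive closures are composites\<close>

inductive_set composites :: "nat set \<Rightarrow> 'a cube set \<Rightarrow> 'a cube set" for S Y where
  base: "\<gamma> \<in> Y \<Longrightarrow> \<gamma> \<in> composites S Y"
| paste: "\<gamma> \<in> composites S Y \<Longrightarrow> \<delta> \<in> composites S Y \<Longrightarrow> i \<in> S \<Longrightarrow> abut S i \<gamma> \<delta>
    \<Longrightarrow> paste i \<gamma> \<delta> \<in> composites S Y"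

lemma paste_closed_composites: "paste_closed S (composites S Y)"
  by (auto simp: paste_closed_def intro: composites.paste)

lemma composites_minimal: "Y \<subseteq> R \<Longrightarrow> paste_closed S R \<Longrightarrow> composites S Y \<subseteq> R"
proof
  fix \<gamma> assume R: "Y \<subseteq> R" "paste_closed S R" and "\<gamma> \<in> composites S Y"
  from this(3) show "\<gamma> \<in> R"
    by induction (use R in \<open>auto simp: paste_closed_def\<close>)
qed

lemma composites_in_cubes: "Y \<subseteq> cubes A S \<Longrightarrow> composites S Y \<subseteq> cubes A S"
  by (rule composites_minimal) (auto simp: paste_closed_def intro: paste_in_cubes)

text \<open>A path in the relation of faces in direction \<open>i\<close> is a row of abutting cubes, pasted from left to
  right.\<close>

lemma trans_closure_subset_composites:
  assumes "i \<in> S" "Y \<subseteq> cubes A S" "Z \<subseteq> composites S Y"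
  shows "trans_closure S i Z \<subseteq> composites S Y"
proof -
  have Z: "Z \<subseteq> cubes A S"
    using assms(3) composites_in_cubes[OF assms(2)] by blast
  have "a \<in> cubes A (S - {i}) \<and> b \<in> cubes A (S - {i}) \<and> glue S i (a, b) \<in> composites S Y"
    if "(a, b) \<in> (faces S i ` Z)\<^sup>+" for a b
    using that
  proof (induction rule: trancl_induct)
    case (base b)
    then obtain \<gamma> where \<gamma>: "\<gamma> \<in> Z" "(a, b) = faces S i \<gamma>"
      by auto
    then have "glue S i (a, b) = \<gamma>"
      using Z glue_faces[OF assms(1), of \<gamma> A] by auto
    then show ?case
      using \<gamma> Z assms(3) face_in_cubes[OF assms(1), of _ \<gamma> A]
      by (auto simp: faces_def)
  next
    case (step b c)
    then obtain \<delta> where \<delta>: "\<delta> \<in> Z" "b = face S i 0 \<delta>" "c = face S i 1 \<delta>"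
      by (auto simp: faces_def)
    have c: "c \<in> cubes A (S - {i})"
      using Z \<delta> face_in_cubes[OF assms(1), of 1 \<delta> A] by auto
    have "faces S i (glue S i (a, b)) = (a, b)"
      using step by (intro faces_glue[OF assms(1), of _ A]) auto
    then have f: "face S i 0 (glue S i (a, b)) = a" "face S i 1 (glue S i (a, b)) = b"
      by (auto simp: faces_def)
    have "glue S i (a, b) \<in> cubes A S" "\<delta> \<in> cubes A S"
      using step \<delta> Z by (auto intro: glue_in_cubes)
    then have "glue S i (a, c) = paste i (glue S i (a, b)) \<delta>"
      by (simp add: paste_eq_glue[OF assms(1), of _ A] f(1) \<delta>(3))
    moreover have "abut S i (glue S i (a, b)) \<delta>"
      unfolding abut_iff_faces_eq[OF assms(1)] f(2) by (rule \<delta>(2))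
    ultimately show ?case
      using step c \<delta> assms by (auto intro: composites.paste)
  qed
  then show ?thesis
    by (auto simp: trans_closure_def)
qed

lemma subset_trans_closure:
  assumes "i \<in> S" "Y \<subseteq> cubes A S"
  shows "Y \<subseteq> trans_closure S i Y"
proof
  fix \<gamma> assume "\<gamma> \<in> Y"
  then have "faces S i \<gamma> \<in> (faces S i ` Y)\<^sup>+"
    by (intro r_into_trancl') auto
  then have "glue S i (faces S i \<gamma>) \<in> trans_closure S i Y"
    unfolding trans_closure_def by (rule imageI)
  then show "\<gamma> \<in> trans_closure S i Y"
    using glue_faces[OF assms(1) subsetD[OF assms(2) \<open>\<gamma> \<in> Y\<close>]] by simp
qed

lemma paste_in_trans_closure:
  assumes "i \<in> S" "Y \<subseteq> cubes A S" "\<gamma> \<in> Y" "\<delta> \<in> Y" "abut S i \<gamma> \<delta>"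
  shows "paste i \<gamma> \<delta> \<in> trans_closure S i Y"
proof -
  have "(face S i 0 \<gamma>, face S i 1 \<gamma>) \<in> faces S i ` Y" "(face S i 0 \<delta>, face S i 1 \<delta>) \<in> faces S i ` Y"
    using assms(3,4) by (auto simp: faces_def)
  then have "(face S i 0 \<gamma>, face S i 1 \<delta>) \<in> (faces S i ` Y)\<^sup>+"
    using assms(5) unfolding abut_iff_faces_eq[OF assms(1)]
    by (simp only: trancl.trancl_into_trancl[OF r_into_trancl])
  then have "glue S i (face S i 0 \<gamma>, face S i 1 \<delta>) \<in> trans_closure S i Y"
    unfolding trans_closure_def by (rule imageI)
  then show ?thesis
    using paste_eq_glue[OF assms(1) subsetD[OF assms(2,3)] subsetD[OF assms(2,4)]] by simp
qed

lemma TC_eq_composites: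
  assumes "finite S" "S \<noteq> {}" "bij_betw e {..<card S} S" "Y \<subseteq> cubes A S"
  shows "TC S e Y = composites S Y"
proof
  have n: "card S > 0"
    using assms by (simp add: card_gt_0_iff)
  have e: "e (j mod card S) \<in> S" for j
    using bij_betw_apply[OF assms(3)] n by simp
  have e0: "e 0 \<in> S"
    using e[of 0] by simp
  have sub: "TC_step S e j Y \<subseteq> composites S Y" for j
  proof (induction j)
    case 0
    show ?case
      using trans_closure_subset_composites[OF e0 assms(4), of Y] composites.base by auto
  next
    case (Suc j)
    then show ?case
      using trans_closure_subset_composites[OF e assms(4)] by simp
  qed
  then show "TC S e Y \<subseteq> composites S Y"
    by (auto simp: TC_def)
  have cub: "TC_step S e j Y \<subseteq> cubes A S" for j
    using sub composites_in_cubes[OF assms(4)] by blast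
  have mono: "TC_step S e j Y \<subseteq> TC_step S e k Y" if "j \<le> k" for j k
    by (rule lift_Suc_mono_le[OF _ that]) (use subset_trans_closure[OF e cub] in simp)
  show "composites S Y \<subseteq> TC S e Y"
  proof (rule composites_minimal)
    have "Y \<subseteq> TC_step S e 0 Y"
      using subset_trans_closure[OF e0 assms(4)] by simp
    then show "Y \<subseteq> TC S e Y"
      unfolding TC_def by blast
    show "paste_closed S (TC S e Y)"
      unfolding paste_closed_def
    proof (intro ballI impI)
      fix \<gamma> \<delta> i
      assume "\<gamma> \<in> TC S e Y" "\<delta> \<in> TC S e Y" and i: "i \<in> S" and ab: "abut S i \<gamma> \<delta>"
      then obtain j k where jk: "\<gamma> \<in> TC_step S e j Y" "\<delta> \<in> TC_step S e k Y"
        by (auto simp: TC_def)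
      have "i \<in> e ` {..<card S}"
        using i by (simp only: bij_betw_imp_surj_on[OF assms(3)])
      then obtain l where l: "l < card S" "e l = i"
        by blast
      \<comment> \<open>A later stage at which direction \<open>i\<close> is closed, chosen so that both cubes are already
        present at the stage before.\<close>
      define M where "M = (j + k) * card S + card S + l - 1"
      have M: "Suc M = (j + k + 1) * card S + l"
        using n by (simp add: M_def)
      have "(j + k) * 1 \<le> (j + k) * card S"
        using n by (intro mult_le_mono2) simp
      then have "j + k \<le> M"
        using M n by (simp add: algebra_simps)
      then have "j \<le> M" "k \<le> M"
        by simp_all
      then have "\<gamma> \<in> TC_step S e M Y" "\<delta> \<in> TC_step S e M Y"
        using jk mono by blast+
      then have "paste i \<gamma> \<delta> \<in> trans_closure S i (TC_step S e M Y)"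
        using paste_in_trans_closure[OF i cub] ab by blast
      moreover have "e (Suc M mod card S) = i"
        using l by (simp only: M mod_mult_self3 mod_less)
      ultimately have "paste i \<gamma> \<delta> \<in> TC_step S e (Suc M) Y"
        by simp
      then show "paste i \<gamma> \<delta> \<in> TC S e Y"
        unfolding TC_def by blast
    qed
  qed
qed

text \<open>A reflection in the direction of a pasting exchanges the two parts, a degeneracy in that
  direction sees only one of them, and everything in another direction acts on each part.\<close>

lemma sym_refl_closed_composites:
  assumes "sym_refl_closed S Y"
  shows "sym_refl_closed S (composites S Y)"
proof -
  have "sym_cube S i \<gamma> \<in> composites S Y \<and> (\<forall>j\<in>{0, 1}. refl_cube S i j \<gamma> \<in> composites S Y)"
    if "\<gamma> \<in> composites S Y" and i: "i \<in> S" for \<gamma> i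
    using that(1)
  proof induction
    case (base \<gamma>)
    then show ?case
      using assms i by (auto simp: sym_refl_closed_def intro: composites.base)
  next
    case (paste \<gamma> \<delta> k)
    note k = \<open>k \<in> S\<close> and ab = \<open>abut S k \<gamma> \<delta>\<close>
    show ?case
    proof (cases "k = i")
      case True
      have "sym_cube S i (paste k \<gamma> \<delta>) = paste k (sym_cube S i \<delta>) (sym_cube S i \<gamma>)"
        using bin_cases[OF i]
        by (auto simp: sym_cube_eq[OF i] reindex_def paste_def fun_eq_iff True)
      moreover have "abut S k (sym_cube S i \<delta>) (sym_cube S i \<gamma>)"
        using ab bin_update[OF i] by (simp add: sym_cube_eq[OF i] abut_def reindex_def True)
      moreover have "refl_cube S i 0 (paste k \<gamma> \<delta>) = refl_cube S i 0 \<gamma>"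
        "refl_cube S i 1 (paste k \<gamma> \<delta>) = refl_cube S i 1 \<delta>"
        by (auto simp: refl_cube_eq[OF i] reindex_def paste_def fun_eq_iff True)
      ultimately show ?thesis
        using paste k by (auto intro: composites.paste)
    next
      case False
      have paste_comm: "reindex S (\<lambda>f. f(i := h f)) (paste k \<gamma> \<delta>)
          = paste k (reindex S (\<lambda>f. f(i := h f)) \<gamma>) (reindex S (\<lambda>f. f(i := h f)) \<delta>)" for h
        using False by (auto simp: reindex_def paste_def fun_eq_iff)
      have abut_comm: "abut S k (reindex S (\<lambda>f. f(i := h f)) \<gamma>) (reindex S (\<lambda>f. f(i := h f)) \<delta>)"
        if h: "\<And>f. f \<in> bin S \<Longrightarrow> h f \<in> {0, 1}" "\<And>f j. h (f(k := j)) = h f" for h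
        unfolding abut_def
      proof
        fix f assume f: "f \<in> bin S"
        have "\<gamma> ((f(i := h f))(k := 1)) = \<delta> ((f(i := h f))(k := 0))"
          using ab bin_update[OF i f h(1)[OF f]] by (simp add: abut_def)
        then show "reindex S (\<lambda>f. f(i := h f)) \<gamma> (f(k := 1))
            = reindex S (\<lambda>f. f(i := h f)) \<delta> (f(k := 0))"
          using bin_update[OF k f] False
          by (simp add: reindex_def h(2) fun_upd_twist[of k i])
      qed
      have "sym_cube S i (paste k \<gamma> \<delta>) \<in> composites S Y"
        unfolding sym_cube_eq[OF i] paste_comm
        using paste k False bin_cases[OF i]
        by (intro composites.paste abut_comm) (auto simp: sym_cube_eq[OF i])
      moreover have "refl_cube S i j (paste k \<gamma> \<delta>) \<in> composites S Y" if "j \<in> {0, 1}" for j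
        unfolding refl_cube_eq[OF i] paste_comm
        using paste k that
        by (intro composites.paste abut_comm) (auto simp: refl_cube_eq[OF i])
      ultimately show ?thesis
        by blast
    qed
  qed
  then show ?thesis
    by (auto simp: sym_refl_closed_def)
qed

section \<open>Operations on composites\<close>

lemma coordinatewise_reindex:
  assumes "\<And>f. f \<in> bin S \<Longrightarrow> \<phi> f \<in> bin S"
  shows "coordinatewise S p (map (reindex S \<phi>) \<gamma>s) = reindex S \<phi> (coordinatewise S p \<gamma>s)"
  using assms by (auto simp: coordinatewise_def reindex_def fun_eq_iff comp_def)

text \<open>The arguments are replaced by composites one at a time. If the next argument is a pasting of
  \<open>\<alpha>\<close> and \<open>\<alpha>'\<close>, the value is the pasting of two values with the arguments \<open>\<alpha>\<close> and \<open>\<alpha>'\<close>; the other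
  arguments stay put during the first half, as their own \<open>0\<close>-degeneracies, and move during the second.
  Degeneracies preserve the given set and its composites, so the induction hypotheses, which are for
  arbitrary other arguments, apply.\<close>

lemma closed_under_composites:
  assumes "closed_under S m p Y" "sym_refl_closed S Y"
  shows "closed_under S m p (composites S Y)"
proof -
  have "coordinatewise S p (\<alpha>s @ \<gamma>s) \<in> composites S Y"
    if "length \<alpha>s = n" "set \<alpha>s \<subseteq> composites S Y" "set \<gamma>s \<subseteq> Y" "length \<alpha>s + length \<gamma>s = m"
    for n \<alpha>s \<gamma>s
    using that
  proof (induction n arbitrary: \<alpha>s \<gamma>s)
    case 0
    then show ?case
      using assms(1) by (auto simp: closed_under_def tuples_def intro: composites.base)
  next
    case (Suc n)
    have main: "coordinatewise S p (\<beta>s @ \<alpha> # \<gamma>s) \<in> composites S Y"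
      if "\<alpha> \<in> composites S Y" "length \<beta>s = n" "set \<beta>s \<subseteq> composites S Y" "set \<gamma>s \<subseteq> Y"
        "Suc (length \<beta>s + length \<gamma>s) = m" for \<alpha> \<beta>s \<gamma>s
      using that
    proof (induction \<alpha> arbitrary: \<beta>s \<gamma>s)
      case (base \<alpha>)
      then show ?case
        using Suc.IH[of \<beta>s "\<alpha> # \<gamma>s"] by simp
    next
      case (paste \<alpha> \<alpha>' i)
      let ?r = "reindex S (\<lambda>f. f(i := 0))"
      \<comment> \<open>On the left only \<open>\<alpha>\<close> varies in direction \<open>i\<close>, so that everything else is at its start
        when \<open>\<alpha>'\<close> takes over.\<close>
      let ?L = "coordinatewise S p (map ?r \<beta>s @ \<alpha> # map ?r \<gamma>s)"
      let ?R = "coordinatewise S p (\<beta>s @ \<alpha>' # \<gamma>s)"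
      have i: "i \<in> S" by fact
      have r: "?r \<gamma> \<in> Z" if "\<gamma> \<in> Z" "sym_refl_closed S Z" for \<gamma> Z
        using sym_refl_closed_reflD[OF that(2,1) i, of 0] by simp
      have "?L \<in> composites S Y"
        using paste.prems r assms(2) sym_refl_closed_composites[OF assms(2)]
        by (intro paste.IH) auto
      moreover have "?R \<in> composites S Y"
        using paste.prems by (intro paste.IH) auto
      moreover have "abut S i ?L ?R"
        using \<open>abut S i \<alpha> \<alpha>'\<close> bin_update[OF i]
        by (simp add: abut_def coordinatewise_def reindex_def comp_def)
      moreover have "paste i ?L ?R = coordinatewise S p (\<beta>s @ paste i \<alpha> \<alpha>' # \<gamma>s)"
      proof
        fix f
        show "paste i ?L ?R f = coordinatewise S p (\<beta>s @ paste i \<alpha> \<alpha>' # \<gamma>s) f"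
          using fun_upd_idem[of f i 0]
          by (auto simp: paste_def coordinatewise_def reindex_def comp_def)
      qed
      ultimately show ?case
        using composites.paste[OF _ _ i, of ?L Y ?R] by simp
    qed
    obtain \<beta>s \<alpha> where "\<alpha>s = \<beta>s @ [\<alpha>]"
      using Suc.prems(1) by (metis length_Suc_conv_rev)
    then show ?case
      using Suc.prems main[of \<alpha> \<beta>s \<gamma>s] by simp
  qed
  then show ?thesis
    by (fastforce simp: closed_under_def tuples_def dest: spec[of _ "[]"])
qed

definition at_most_one_nondegenerate :: "nat set \<Rightarrow> nat \<Rightarrow> 'a cube list \<Rightarrow> bool" where
  "at_most_one_nondegenerate S i \<gamma>s \<longleftrightarrow> (\<exists>w. \<forall>u<length \<gamma>s. u \<noteq> w \<longrightarrow> degenerate S i (\<gamma>s ! u))"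

text \<open>Subdivision into cells, by induction on the set \<open>D\<close> of directions in which several arguments may
  vary. For a direction \<open>i\<close> in \<open>D\<close>, let the arguments move from their \<open>0\<close>-face to their \<open>1\<close>-face in
  turn; the position of an argument before and after its move is a degeneracy. This writes the value
  as a row of cells, in each of which one argument varies in direction \<open>i\<close>. Passing to degeneracies
  creates no variation in other directions, so the directions outside \<open>D\<close> remain as they are.\<close>

lemma closed_under_if_closed_on_cells:
  assumes "finite S" "sym_refl_closed S R" "paste_closed S R"
    and cells: "\<And>\<gamma>s. \<gamma>s \<in> tuples R k \<Longrightarrow> \<forall>i\<in>S. at_most_one_nondegenerate S i \<gamma>s
      \<Longrightarrow> coordinatewise S q \<gamma>s \<in> R"
  shows "closed_under S k q R"
proof -
  have "finite D \<Longrightarrow> D \<subseteq> S \<Longrightarrow> \<gamma>s \<in> tuples R k \<Longrightarrow> \<forall>i\<in>S - D. at_most_one_nondegenerate S i \<gamma>s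
      \<Longrightarrow> coordinatewise S q \<gamma>s \<in> R" for D \<gamma>s
  proof (induction D arbitrary: \<gamma>s rule: finite_induct)
    case empty
    then show ?case
      using cells by simp
  next
    case (insert i D)
    have i: "i \<in> S"
      using insert.prems by simp
    have len: "length \<gamma>s = k" and R: "\<And>u. u < k \<Longrightarrow> \<gamma>s ! u \<in> R"
      using insert.prems(2) by (auto simp: tuples_def)
    let ?r = "\<lambda>j. reindex S (\<lambda>f. f(i := j))"
    have r: "?r j \<gamma> \<in> R" if "\<gamma> \<in> R" "j \<in> {0, 1}" for j \<gamma>
      using sym_refl_closed_reflD[OF assms(2) that(1) i that(2)] .
    have others: "at_most_one_nondegenerate S i' (map g [0..<k])"
      if i': "i' \<in> S - insert i D"
        and g: "\<And>u. u < k \<Longrightarrow> g u \<in> {\<gamma>s ! u, ?r 0 (\<gamma>s ! u), ?r 1 (\<gamma>s ! u)}" for i' g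
    proof -
      obtain w where w: "\<And>u. u < k \<Longrightarrow> u \<noteq> w \<Longrightarrow> degenerate S i' (\<gamma>s ! u)"
        using bspec[OF insert.prems(3) i'] unfolding at_most_one_nondegenerate_def len by blast
      have "degenerate S i' (g u)" if "u < k" "u \<noteq> w" for u
      proof -
        have "degenerate S i' (?r j (\<gamma>s ! u))" if "j \<in> {0, 1}" for j
          using degenerate_reindex[OF i that _ w] i' \<open>u < k\<close> \<open>u \<noteq> w\<close> by blast
        then show ?thesis
          using w[OF that] g[OF that(1)] by fastforce
      qed
      then show ?thesis
        by (auto simp: at_most_one_nondegenerate_def)
    qed
    have IH: "coordinatewise S q (map g [0..<k]) \<in> R"
      if g: "\<And>u. u < k \<Longrightarrow> g u \<in> {\<gamma>s ! u, ?r 0 (\<gamma>s ! u), ?r 1 (\<gamma>s ! u)}"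
        and w: "\<And>u. u < k \<Longrightarrow> u \<noteq> w \<Longrightarrow> degenerate S i (g u)" for g w
    proof (rule insert.IH)
      have "g u \<in> R" if "u < k" for u
        using g[OF that] R[OF that] r[OF R[OF that], of 0] r[OF R[OF that], of 1] by auto
      then show "map g [0..<k] \<in> tuples R k"
        by (auto simp: tuples_def)
      show "D \<subseteq> S"
        using insert.prems(1) by simp
      have "at_most_one_nondegenerate S i (map g [0..<k])"
        using w by (auto simp: at_most_one_nondegenerate_def)
      then show "\<forall>i'\<in>S - D. at_most_one_nondegenerate S i' (map g [0..<k])"
        using others[OF _ g] by (metis DiffD1 DiffD2 DiffI insertE)
    qed
    \<comment> \<open>\<open>?path l\<close> is the part of the row in which the first \<open>l\<close> arguments have moved, and \<open>?cell l\<close>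
      is the cell in which argument \<open>l\<close> moves.\<close>
    let ?path = "\<lambda>l. coordinatewise S q (map (\<lambda>u. if u < l then \<gamma>s ! u else ?r 0 (\<gamma>s ! u)) [0..<k])"
    let ?cell = "\<lambda>l. coordinatewise S q (map (\<lambda>u. if u < l then ?r 1 (\<gamma>s ! u) else
        if u = l then \<gamma>s ! u else ?r 0 (\<gamma>s ! u)) [0..<k])"
    have path: "?path l \<in> R" for l
    proof (induction l)
      case 0
      show ?case
        using degenerate_reindex_same[OF i] by (intro IH) auto
    next
      case (Suc l)
      have "?cell l \<in> R"
        using degenerate_reindex_same[OF i] by (intro IH[of _ l]) auto
      moreover have "abut S i (?path l) (?cell l)"
        unfolding abut_def
      proof
        fix f assume "f \<in> bin S"
        then show "?path l (f(i := 1)) = ?cell l (f(i := 0))"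
          using bin_update[OF i]
          by (auto simp: coordinatewise_def reindex_def comp_def intro!: arg_cong[of _ _ q])
      qed
      moreover have "paste i (?path l) (?cell l) = ?path (Suc l)"
      proof
        fix f
        show "paste i (?path l) (?cell l) f = ?path (Suc l) f"
        proof (cases "f \<in> bin S")
          case True
          consider "f i = 0" "f(i := 0) = f" | "f i = 1" "f(i := 1) = f"
            using bin_cases[OF i True] by (metis fun_upd_triv)
          then show ?thesis
            using True
            by cases (auto simp: paste_def coordinatewise_def reindex_def comp_def
                intro!: arg_cong[of _ _ q])
        qed (simp add: paste_def coordinatewise_def)
      qed
      ultimately show ?case
        using paste_closedD[OF assms(3) Suc _ i, of "?cell l"] by simp
    qed
    have "map (\<lambda>u. if u < k then \<gamma>s ! u else ?r 0 (\<gamma>s ! u)) [0..<k] = \<gamma>s"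
      using len by (intro nth_equalityI) auto
    then show ?case
      using path[of k] by (simp only:)
  qed
  from this[OF assms(1)] show ?thesis
    by (simp add: closed_under_def)
qed

section \<open>Polynomial operations\<close>

lemma eval_trm_closed:
  assumes "is_algebra \<CC>" "wf_trm \<CC> m t" "xs \<in> tuples (universe \<CC>) m"
  shows "eval_trm \<CC> t xs \<in> universe \<CC>"
  using assms(2)
proof (induction t)
  case (Var i)
  then show ?case
    using assms(3) by (auto simp: tuples_def)
next
  case (App F ts)
  then have "map (\<lambda>t. eval_trm \<CC> t xs) ts \<in> tuples (universe \<CC>) (arity \<CC> F)"
    by (auto simp: tuples_def)
  then show ?case
    using assms(1) App.prems by (simp add: is_algebra_def)
qed

lemma Pol_closed:
  assumes "is_algebra \<CC>" "p \<in> Pol m \<CC>" "xs \<in> tuples (universe \<CC>) m"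
  shows "p xs \<in> universe \<CC>"
  using assms by (force simp: Pol_def term_ops_def tuples_def intro!: eval_trm_closed)

lemma coordinatewise_Pol_in_cubes:
  assumes "is_algebra \<CC>" "p \<in> Pol m \<CC>" "\<gamma>s \<in> tuples (cubes (universe \<CC>) S) m"
  shows "coordinatewise S p \<gamma>s \<in> cubes (universe \<CC>) S"
proof -
  have "map (\<lambda>\<gamma>. \<gamma> f) \<gamma>s \<in> tuples (universe \<CC>) m" if "f \<in> bin S" for f
    using assms(3) that by (auto simp: tuples_def cube_label)
  then show ?thesis
    using Pol_closed[OF assms(1,2)] by (auto simp: coordinatewise_def cubes_def PiE_iff)
qed

text \<open>Elements of \<open>Pol\<close> are restricted to tuples over the algebra, so membership of an operation given by
  a term with constants is only up to agreement on these tuples.\<close>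

lemma Pol_of_term:
  assumes "wf_trm \<CC> (m + k) t" "cs \<in> tuples (universe \<CC>) k"
    and "\<And>xs. xs \<in> tuples (universe \<CC>) m \<Longrightarrow> p xs = eval_trm \<CC> t (xs @ cs)"
  shows "\<exists>p'\<in>Pol m \<CC>. \<forall>xs\<in>tuples (universe \<CC>) m. p' xs = p xs"
proof
  let ?t = "\<lambda>xs\<in>tuples (universe \<CC>) (m + k). eval_trm \<CC> t xs"
  have "?t \<in> term_ops \<CC> (m + k)"
    using assms(1) by (auto simp: term_ops_def)
  then show "(\<lambda>xs\<in>tuples (universe \<CC>) m. ?t (xs @ cs)) \<in> Pol m \<CC>"
    using assms(2) unfolding Pol_def by blast
  show "\<forall>xs\<in>tuples (universe \<CC>) m. (\<lambda>xs\<in>tuples (universe \<CC>) m. ?t (xs @ cs)) xs = p xs"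
    using assms(2,3) by (auto simp: tuples_def)
qed

lemma coordinatewise_term:
  assumes "\<And>F. F \<in> symbols \<CC> \<Longrightarrow> closed_under S (arity \<CC> F) (interp \<CC> F) R"
    and "\<gamma>s \<in> tuples R m" "R \<subseteq> cubes A S" "wf_trm \<CC> m t"
  shows "coordinatewise S (eval_trm \<CC> t) \<gamma>s \<in> R"
  using assms(4)
proof (induction t)
  case (Var i)
  then have i: "\<gamma>s ! i \<in> R" "i < length \<gamma>s"
    using assms(2) by (auto simp: tuples_def)
  then have "coordinatewise S (eval_trm \<CC> (Var i)) \<gamma>s = \<gamma>s ! i"
    using cube_undefined[of "\<gamma>s ! i" A S] assms(3) by (auto simp: coordinatewise_def fun_eq_iff)
  then show ?case
    using i(1) by (simp only:)
next
  case (App F ts)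
  have "coordinatewise S (eval_trm \<CC> (App F ts)) \<gamma>s
      = coordinatewise S (interp \<CC> F) (map (\<lambda>t. coordinatewise S (eval_trm \<CC> t) \<gamma>s) ts)"
    by (auto simp: coordinatewise_def fun_eq_iff comp_def)
  moreover have "map (\<lambda>t. coordinatewise S (eval_trm \<CC> t) \<gamma>s) ts \<in> tuples R (arity \<CC> F)"
    using App by (auto simp: tuples_def)
  moreover have "F \<in> symbols \<CC>"
    using App.prems by simp
  ultimately show ?case
    using assms(1)[of F] unfolding closed_under_def by (simp only:)
qed

text \<open>Constants of a polynomial become constant cubes as further arguments of a term operation.\<close>

lemma closed_under_Pol:
  assumes "\<And>F. F \<in> symbols \<CC> \<Longrightarrow> closed_under S (arity \<CC> F) (interp \<CC> F) R"
    and "R \<subseteq> cubes (universe \<CC>) S" "\<And>c. c \<in> universe \<CC> \<Longrightarrow> const_cube S c \<in> R"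
    and "p \<in> Pol m \<CC>"
  shows "closed_under S m p R"
  unfolding closed_under_def
proof
  fix \<gamma>s assume \<gamma>s: "\<gamma>s \<in> tuples R m"
  obtain t k cs where t: "wf_trm \<CC> (m + k) t" "cs \<in> tuples (universe \<CC>) k"
    and p: "p = (\<lambda>xs\<in>tuples (universe \<CC>) m.
      (\<lambda>xs\<in>tuples (universe \<CC>) (m + k). eval_trm \<CC> t xs) (xs @ cs))"
    using assms(4) by (auto simp: Pol_def term_ops_def)
  have "\<gamma>s @ map (const_cube S) cs \<in> tuples R (m + k)"
    using \<gamma>s t(2) assms(3) by (auto simp: tuples_def)
  from coordinatewise_term[OF assms(1) this assms(2) t(1)]
  have "coordinatewise S (eval_trm \<CC> t) (\<gamma>s @ map (const_cube S) cs) \<in> R"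
    by simp
  also have "coordinatewise S (eval_trm \<CC> t) (\<gamma>s @ map (const_cube S) cs) = coordinatewise S p \<gamma>s"
  proof
    fix f
    show "coordinatewise S (eval_trm \<CC> t) (\<gamma>s @ map (const_cube S) cs) f = coordinatewise S p \<gamma>s f"
    proof (cases "f \<in> bin S")
      case True
      then have "map (\<lambda>\<gamma>. \<gamma> f) \<gamma>s \<in> tuples (universe \<CC>) m"
        using \<gamma>s assms(2) by (auto simp: tuples_def cube_label subset_iff)
      then show ?thesis
        using True t(2) by (auto simp: coordinatewise_def p const_cube_def comp_def tuples_def)
    qed (simp add: coordinatewise_def)
  qed
  finally show "coordinatewise S p \<gamma>s \<in> R" .
qed

text \<open>For each direction \<open>i\<close>, let \<open>w i\<close> be an argument outside of which nothing varies in direction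
  \<open>i\<close>. Arguments not of the form \<open>w i\<close> are constant cubes. So \<open>F\<close> is applied to the cubes at the
  positions \<open>w (e 0), \<dots>, w (e (n - 1))\<close>, possibly with repetitions, and to constants.\<close>

lemma coordinatewise_cell:
  assumes "is_algebra \<CC>" "finite S" "bij_betw e {..<card S} S"
    and F: "F \<in> symbols \<CC>"
    and R: "R \<subseteq> cubes (universe \<CC>) S" "\<And>c. c \<in> universe \<CC> \<Longrightarrow> const_cube S c \<in> R"
    and Pol: "\<And>p. p \<in> Pol (card S) \<CC> \<Longrightarrow> closed_under S (card S) p R"
    and \<gamma>s: "\<gamma>s \<in> tuples R (arity \<CC> F)" "\<forall>i\<in>S. at_most_one_nondegenerate S i \<gamma>s"
  shows "coordinatewise S (interp \<CC> F) \<gamma>s \<in> R"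
proof (cases "arity \<CC> F = 0")
  case True
  then have "interp \<CC> F [] \<in> universe \<CC>"
    using assms(1) F by (auto simp: is_algebra_def tuples_def)
  moreover have "coordinatewise S (interp \<CC> F) \<gamma>s = const_cube S (interp \<CC> F [])"
    using True \<gamma>s(1) by (simp add: coordinatewise_def const_cube_def tuples_def)
  ultimately show ?thesis
    using R(2) by simp
next
  case False
  define n where "n = card S"
  define k where "k = arity \<CC> F"
  have len: "length \<gamma>s = k" and \<gamma>sR: "\<And>u. u < k \<Longrightarrow> \<gamma>s ! u \<in> R"
    using \<gamma>s(1) by (auto simp: tuples_def k_def)
  have "\<forall>i\<in>S. \<exists>w<k. \<forall>u<k. u \<noteq> w \<longrightarrow> degenerate S i (\<gamma>s ! u)"
  proof
    fix i assume "i \<in> S"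
    then obtain w where w: "\<forall>u<k. u \<noteq> w \<longrightarrow> degenerate S i (\<gamma>s ! u)"
      using \<gamma>s(2) unfolding at_most_one_nondegenerate_def len by blast
    \<comment> \<open>If \<open>w\<close> lies beyond the list, no argument varies and any index of the list will do.\<close>
    show "\<exists>w<k. \<forall>u<k. u \<noteq> w \<longrightarrow> degenerate S i (\<gamma>s ! u)"
    proof (cases "w < k")
      case True
      then show ?thesis
        using w by blast
    next
      case False
      then have "\<forall>u<k. degenerate S i (\<gamma>s ! u)"
        using w by auto
      then show ?thesis
        using \<open>arity \<CC> F \<noteq> 0\<close> by (auto simp: k_def)
    qed
  qed
  then obtain w where w: "\<And>i. i \<in> S \<Longrightarrow> w i < k"
    "\<And>i u. i \<in> S \<Longrightarrow> u < k \<Longrightarrow> u \<noteq> w i \<Longrightarrow> degenerate S i (\<gamma>s ! u)"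
    by metis
  have e: "e v \<in> S" if "v < n" for v
    using bij_betw_apply[OF assms(3)] that by (simp add: n_def)
  have e_surj: "\<exists>v<n. e v = i" if "i \<in> S" for i
  proof -
    have "i \<in> e ` {..<n}"
      using that by (simp only: n_def bij_betw_imp_surj_on[OF assms(3)])
    then show ?thesis
      by blast
  qed
  \<comment> \<open>The variable that takes the place of argument \<open>u\<close>; variables from \<open>n\<close> on receive the
    constants \<open>cs\<close>.\<close>
  define pos where "pos u = (if u \<in> w ` S then SOME v. v < n \<and> w (e v) = u else n + u)" for u
  have pos: "pos u < n" "w (e (pos u)) = u" if "u \<in> w ` S" for u
  proof -
    have "\<exists>v. v < n \<and> w (e v) = u"
      using that e_surj by blast
    from someI_ex[OF this] show "pos u < n" "w (e (pos u)) = u"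
      using that by (auto simp: pos_def)
  qed
  \<comment> \<open>Constant cubes are read off at an arbitrary vertex. The entries of \<open>cs\<close> at nonconstant arguments
    are fillers that keep the numbering of the variables uniform.\<close>
  define f0 where "f0 = (\<lambda>i\<in>S. 0 :: nat)"
  have f0: "f0 \<in> bin S"
    by (simp add: f0_def bin_def)
  define cs where "cs = map (\<lambda>\<gamma>. \<gamma> f0) \<gamma>s"
  have cs: "cs \<in> tuples (universe \<CC>) k"
    using \<gamma>s(1) R(1) cube_label[OF _ f0] by (auto simp: cs_def tuples_def k_def subset_iff)
  define t where "t = App F (map (\<lambda>u. Var (pos u)) [0..<k])"
  have pos_less: "pos u < n + k" if "u < k" for u
    using pos(1)[of u] that by (cases "u \<in> w ` S") (auto simp: pos_def)
  then have "wf_trm \<CC> (n + k) t"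
    using F by (simp add: t_def k_def)
  from Pol_of_term[OF this cs, of "\<lambda>xs. eval_trm \<CC> t (xs @ cs)"] obtain p where p: "p \<in> Pol n \<CC>"
    "\<And>xs. xs \<in> tuples (universe \<CC>) n \<Longrightarrow> p xs = eval_trm \<CC> t (xs @ cs)"
    by auto
  define \<delta>s where "\<delta>s = map (\<lambda>v. \<gamma>s ! w (e v)) [0..<n]"
  have \<delta>s: "\<delta>s \<in> tuples R n"
    using \<gamma>sR w(1) e by (auto simp: \<delta>s_def tuples_def)
  have "coordinatewise S p \<delta>s = coordinatewise S (interp \<CC> F) \<gamma>s"
  proof
    fix f
    show "coordinatewise S p \<delta>s f = coordinatewise S (interp \<CC> F) \<gamma>s f"
    proof (cases "f \<in> bin S")
      case True
      let ?xs = "map (\<lambda>\<gamma>. \<gamma> f) \<delta>s"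
      have xs: "?xs \<in> tuples (universe \<CC>) n"
        using \<delta>s R(1) cube_label[OF _ True] by (auto simp: tuples_def subset_iff)
      have nth: "(?xs @ cs) ! pos u = (\<gamma>s ! u) f" if u: "u < k" for u
      proof (cases "u \<in> w ` S")
        case True
        then show ?thesis
          using pos[OF True] by (simp add: \<delta>s_def nth_append)
      next
        case False
        then have "(\<gamma>s ! u) f = (\<gamma>s ! u) f0"
          using w(2) u by (intro totally_degenerate_label[OF assms(2) _ f0 \<open>f \<in> bin S\<close>]) blast
        then show ?thesis
          using False u len by (simp add: \<delta>s_def pos_def nth_append cs_def)
      qed
      have "map (\<lambda>u. (?xs @ cs) ! pos u) [0..<k] = map (\<lambda>\<gamma>. \<gamma> f) \<gamma>s"
        using len nth by (intro nth_equalityI) simp_all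
      moreover have "eval_trm \<CC> t (?xs @ cs) = interp \<CC> F (map (\<lambda>u. (?xs @ cs) ! pos u) [0..<k])"
        by (simp add: t_def comp_def)
      ultimately have "p ?xs = interp \<CC> F (map (\<lambda>\<gamma>. \<gamma> f) \<gamma>s)"
        using p(2)[OF xs] by (simp only:)
      then show ?thesis
        using True by (simp add: coordinatewise_def)
    qed (simp add: coordinatewise_def)
  qed
  moreover have "coordinatewise S p \<delta>s \<in> R"
    using Pol p(1) \<delta>s by (simp add: closed_under_def n_def)
  ultimately show ?thesis
    by simp
qed

section \<open>The generating procedure\<close>

lemma subuniverse_hull:
  assumes A: "is_algebra \<AA>" "X \<subseteq> universe \<AA>"
  shows "subuniverse \<AA> (subuniverse \<AA> hull X)"
proof -
  have univ: "subuniverse \<AA> (universe \<AA>)"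
    using A(1) by (auto simp: is_algebra_def subuniverse_def)
  show ?thesis
    unfolding subuniverse_def[of \<AA> "subuniverse \<AA> hull X"]
  proof (intro conjI ballI)
    show "subuniverse \<AA> hull X \<subseteq> universe \<AA>"
      using A(2) univ by (rule hull_minimal)
    fix F xs assume "F \<in> symbols \<AA>" "xs \<in> tuples (subuniverse \<AA> hull X) (arity \<AA> F)"
    then show "interp \<AA> F xs \<in> subuniverse \<AA> hull X"
      unfolding hull_def by (auto simp: subuniverse_def tuples_def subset_iff)
  qed
qed

lemma generated_subalgebra_simps [simp]:
  "universe (generated_subalgebra \<AA> X) = subuniverse \<AA> hull X"
  "symbols (generated_subalgebra \<AA> X) = symbols \<AA>"
  "arity (generated_subalgebra \<AA> X) = arity \<AA>"
  "interp (generated_subalgebra \<AA> X) = interp \<AA>"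
  by (simp_all add: generated_subalgebra_def)

text \<open>The elements whose constant cube lies in \<open>R\<close> form a subuniverse, and it contains the labels of
  \<open>G\<close>.\<close>

lemma const_cubes_in_closed:
  assumes "finite S" "G \<subseteq> R" "R \<subseteq> cubes (universe \<AA>) S" "sym_refl_closed S R"
    and ops: "\<And>F. F \<in> symbols \<AA> \<Longrightarrow> closed_under S (arity \<AA> F) (interp \<AA> F) R"
    and "c \<in> subuniverse \<AA> hull (cube_labels S G)"
  shows "const_cube S c \<in> R"
proof -
  let ?B = "{c. const_cube S c \<in> R}"
  have f0: "(\<lambda>i\<in>S. 0) \<in> bin S"
    by (simp add: bin_def)
  have "subuniverse \<AA> ?B"
    unfolding subuniverse_def
  proof (intro conjI ballI)
    show "?B \<subseteq> universe \<AA>"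
      using assms(3) f0 by (auto simp: const_cube_def dest!: subsetD cube_label[OF _ f0])
    fix F xs assume F: "F \<in> symbols \<AA>" and xs: "xs \<in> tuples ?B (arity \<AA> F)"
    have "map (const_cube S) xs \<in> tuples R (arity \<AA> F)"
      using xs by (auto simp: tuples_def)
    moreover have "coordinatewise S (interp \<AA> F) (map (const_cube S) xs) = const_cube S (interp \<AA> F xs)"
      by (auto simp: coordinatewise_def const_cube_def fun_eq_iff comp_def)
    ultimately show "interp \<AA> F xs \<in> ?B"
      using ops[OF F] by (auto simp: closed_under_def)
  qed
  moreover have "cube_labels S G \<subseteq> ?B"
    using const_cube_of_label[OF assms(1,4) _ assms(3)] assms(2) by (auto simp: cube_labels_def)
  ultimately have "subuniverse \<AA> hull (cube_labels S G) \<subseteq> ?B"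
    by (rule hull_minimal[rotated])
  then show ?thesis
    using assms(6) by blast
qed

lemma sym_refl_closed_closure: "sym_refl_closed S (sym_refl_closure S G)"
  unfolding sym_refl_closure_def hull_def sym_refl_closed_def by blast

lemma sym_refl_closure_minimal: "G \<subseteq> R \<Longrightarrow> sym_refl_closed S R \<Longrightarrow> sym_refl_closure S G \<subseteq> R"
  unfolding sym_refl_closure_def sym_refl_closed_def by (rule hull_minimal)

lemma closed_under_pol_closure: "p \<in> Pol m \<CC> \<Longrightarrow> closed_under S m p (pol_closure S m \<CC> G)"
  unfolding pol_closure_def hull_def closed_under_def tuples_def by blast

lemma pol_closure_minimal:
  "G \<subseteq> R \<Longrightarrow> (\<And>p. p \<in> Pol m \<CC> \<Longrightarrow> closed_under S m p R) \<Longrightarrow> pol_closure S m \<CC> G \<subseteq> R"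
  unfolding pol_closure_def by (rule hull_minimal) auto

lemma pol_closure_subset: "G \<subseteq> pol_closure S m \<CC> G"
  unfolding pol_closure_def by (rule hull_subset)

lemma pol_closure_in_cubes:
  assumes "is_algebra \<CC>" "G \<subseteq> cubes (universe \<CC>) S"
  shows "pol_closure S m \<CC> G \<subseteq> cubes (universe \<CC>) S"
  using assms coordinatewise_Pol_in_cubes[OF assms(1)]
  by (intro pol_closure_minimal) (auto simp: closed_under_def)

text \<open>Vertex substitutions commute with coordinatewise operations, so the cubes whose substitution stays
  in the closure form a set closed under the polynomials.\<close>

lemma sym_refl_closed_pol_closure:
  assumes "sym_refl_closed S G"
  shows "sym_refl_closed S (pol_closure S m \<CC> G)"
proof -
  let ?P = "pol_closure S m \<CC> G"
  have reindex: "reindex S \<phi> \<gamma> \<in> ?P"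
    if \<gamma>: "\<gamma> \<in> ?P" and \<phi>: "\<And>f. f \<in> bin S \<Longrightarrow> \<phi> f \<in> bin S" "\<And>\<gamma>. \<gamma> \<in> G \<Longrightarrow> reindex S \<phi> \<gamma> \<in> G" for \<phi> \<gamma>
  proof -
    have "?P \<subseteq> {\<gamma> \<in> ?P. reindex S \<phi> \<gamma> \<in> ?P}"
    proof (rule pol_closure_minimal)
      show "G \<subseteq> {\<gamma> \<in> ?P. reindex S \<phi> \<gamma> \<in> ?P}"
        using \<phi>(2) pol_closure_subset by blast
      fix p assume p: "p \<in> Pol m \<CC>"
      show "closed_under S m p {\<gamma> \<in> ?P. reindex S \<phi> \<gamma> \<in> ?P}"
        unfolding closed_under_def
      proof
        fix \<gamma>s assume "\<gamma>s \<in> tuples {\<gamma> \<in> ?P. reindex S \<phi> \<gamma> \<in> ?P} m"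
        then have "\<gamma>s \<in> tuples ?P m" "map (reindex S \<phi>) \<gamma>s \<in> tuples ?P m"
          by (auto simp: tuples_def)
        then have "coordinatewise S p \<gamma>s \<in> ?P" "coordinatewise S p (map (reindex S \<phi>) \<gamma>s) \<in> ?P"
          using closed_under_pol_closure[OF p] unfolding closed_under_def by blast+
        then show "coordinatewise S p \<gamma>s \<in> {\<gamma> \<in> ?P. reindex S \<phi> \<gamma> \<in> ?P}"
          by (simp add: coordinatewise_reindex[OF \<phi>(1)])
      qed
    qed
    then show ?thesis
      using \<gamma> by blast
  qed
  show ?thesis
    unfolding sym_refl_closed_def
  proof (intro ballI conjI)
    fix \<gamma> i assume \<gamma>: "\<gamma> \<in> ?P" and i: "i \<in> S"
    show "sym_cube S i \<gamma> \<in> ?P"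
      unfolding sym_cube_eq[OF i]
      by (intro reindex[OF \<gamma>] flip_in_bin[OF i] sym_refl_closed_symD[OF assms _ i])
    fix j :: nat assume "j \<in> {0, 1}"
    then show "refl_cube S i j \<gamma> \<in> ?P"
      unfolding refl_cube_eq[OF i] using sym_refl_closed_reflD[OF assms _ i]
      by (intro reindex[OF \<gamma>] bin_update[OF i]) auto
  qed
qed

lemma const_cube_in_pol_closure:
  assumes "G \<noteq> {}" "G \<subseteq> cubes (universe \<CC>) S" "c \<in> universe \<CC>"
  shows "const_cube S c \<in> pol_closure S m \<CC> G"
proof -
  obtain \<gamma> where \<gamma>: "\<gamma> \<in> G"
    using assms(1) by blast
  have "wf_trm \<CC> (m + 1) (Var m)" "[c] \<in> tuples (universe \<CC>) 1"
    using assms(3) by (auto simp: tuples_def)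
  from Pol_of_term[OF this, of "\<lambda>_. c"] obtain p where p: "p \<in> Pol m \<CC>"
    "\<And>xs. xs \<in> tuples (universe \<CC>) m \<Longrightarrow> p xs = c"
    by (auto simp: tuples_def nth_append)
  have \<gamma>s: "replicate m \<gamma> \<in> tuples (pol_closure S m \<CC> G) m"
    using subsetD[OF pol_closure_subset \<gamma>] by (auto simp: tuples_def)
  have "replicate m (\<gamma> f) \<in> tuples (universe \<CC>) m" if "f \<in> bin S" for f
    using cube_label[OF subsetD[OF assms(2) \<gamma>] that] by (auto simp: tuples_def)
  then have "coordinatewise S p (replicate m \<gamma>) = const_cube S c"
    using p(2) by (auto simp: coordinatewise_def const_cube_def fun_eq_iff)
  then show ?thesis
    using closed_under_pol_closure[OF p(1)] \<gamma>s by (metis closed_under_def)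
qed

text \<open>A congruence may contain cubes with labels outside \<open>C(G)\<close>, where the polynomials of \<open>C(G)\<close> are
  not defined. It is therefore cut down to the cubes over a subuniverse, which form a congruence of
  the subalgebra.\<close>

lemma dim_congruence_Int_cubes:
  assumes "dim_congruence \<AA> S R" "subuniverse \<AA> C"
  shows "sym_refl_closed S (R \<inter> cubes C S)" "paste_closed S (R \<inter> cubes C S)"
    "\<And>F. F \<in> symbols \<AA> \<Longrightarrow> closed_under S (arity \<AA> F) (interp \<AA> F) (R \<inter> cubes C S)"
proof -
  have R: "sym_refl_closed S R" "paste_closed S R"
    "\<And>F. F \<in> symbols \<AA> \<Longrightarrow> closed_under S (arity \<AA> F) (interp \<AA> F) R"
    using assms(1) by (auto simp: dim_congruence_def dim_equivalence_iff)
  let ?\<CC> = "\<AA>\<lparr>universe := C\<rparr>"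
  have "dim_congruence ?\<CC> S (cubes (universe ?\<CC>) S)"
    using assms(2) by (intro dim_congruence_cubes) (auto simp: is_algebra_def subuniverse_def)
  then have C: "sym_refl_closed S (cubes C S)" "paste_closed S (cubes C S)"
    "\<And>F. F \<in> symbols \<AA> \<Longrightarrow> closed_under S (arity \<AA> F) (interp \<AA> F) (cubes C S)"
    by (auto simp: dim_congruence_def dim_equivalence_iff)
  show "sym_refl_closed S (R \<inter> cubes C S)" "paste_closed S (R \<inter> cubes C S)"
    using R C by (auto simp: sym_refl_closed_def paste_closed_def)
  show "closed_under S (arity \<AA> F) (interp \<AA> F) (R \<inter> cubes C S)" if "F \<in> symbols \<AA>" for F
    using R(3)[OF that] C(3)[OF that] by (auto simp: closed_under_def tuples_def)
qed

theorem theorem3p7: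
  fixes \<AA> :: "('f, 'a) algebra"
    and S :: "nat set"
    and G G1 G2 :: "'a cube set"
    and e :: "nat \<Rightarrow> nat"
  assumes "is_algebra \<AA>"
    and "finite S" and "S \<noteq> {}"
    and "G \<subseteq> cubes (universe \<AA>) S"
    and "G \<noteq> {} \<or> (\<forall>F\<in>symbols \<AA>. arity \<AA> F > 0)"
    and "bij_betw e {..<card S} S"
    and "G1 = sym_refl_closure S G"
    and "G2 = pol_closure S (card S) (generated_subalgebra \<AA> (cube_labels S G)) G1"
  shows "TC S e G2 = Theta \<AA> S G"
proof -
  define C where "C = subuniverse \<AA> hull (cube_labels S G)"
  let ?\<CC> = "generated_subalgebra \<AA> (cube_labels S G)"
  have "cube_labels S G \<subseteq> universe \<AA>"
  proof
    fix c assume "c \<in> cube_labels S G"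
    then obtain \<gamma> f where "c = \<gamma> f" "\<gamma> \<in> G" "f \<in> bin S"
      unfolding cube_labels_def by blast
    then show "c \<in> universe \<AA>"
      using cube_label[OF subsetD[OF assms(4)]] by simp
  qed
  then have C: "subuniverse \<AA> C"
    unfolding C_def by (rule subuniverse_hull[OF assms(1)])
  then have C_sub: "C \<subseteq> universe \<AA>"
    unfolding subuniverse_def by (rule conjunct1)
  have univ: "universe ?\<CC> = C"
    by (simp add: C_def)
  have alg: "is_algebra ?\<CC>"
    using C unfolding is_algebra_def univ subuniverse_def by simp
  have labels: "cube_labels S G \<subseteq> C"
    unfolding C_def by (rule hull_subset)
  have G: "G \<subseteq> cubes C S"
  proof
    fix \<gamma> assume \<gamma>: "\<gamma> \<in> G"
    have "\<gamma> f \<in> C" if "f \<in> bin S" for f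
      using labels \<gamma> that unfolding cube_labels_def by blast
    moreover have "\<gamma> \<in> extensional (bin S)"
      using subsetD[OF assms(4) \<gamma>] by (simp add: cubes_def PiE_iff)
    ultimately show "\<gamma> \<in> cubes C S"
      by (simp add: cubes_def PiE_iff)
  qed
  have GG1: "G \<subseteq> G1"
    unfolding assms(7) sym_refl_closure_def by (rule hull_subset)
  have G1: "G1 \<subseteq> cubes C S"
    unfolding assms(7) by (rule sym_refl_closure_minimal[OF G sym_refl_closed_cubes])
  have G1_closed: "sym_refl_closed S G1"
    unfolding assms(7) by (rule sym_refl_closed_closure)
  have G1G2: "G1 \<subseteq> G2"
    unfolding assms(8) by (rule pol_closure_subset)
  have G2: "G2 \<subseteq> cubes C S"
    using pol_closure_in_cubes[OF alg, unfolded univ, OF G1] unfolding assms(8) .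
  have G2_closed: "sym_refl_closed S G2"
    unfolding assms(8) by (rule sym_refl_closed_pol_closure[OF G1_closed])
  have G2_Pol: "closed_under S (card S) p G2" if "p \<in> Pol (card S) ?\<CC>" for p
    unfolding assms(8) by (rule closed_under_pol_closure[OF that])
  have G2_const: "const_cube S c \<in> G2" if c: "c \<in> C" for c
  proof (cases "G = {}")
    case True
    then have "subuniverse \<AA> {}"
      using assms(5) by (simp add: subuniverse_def tuples_def)
    moreover have "cube_labels S G \<subseteq> {}"
      by (simp add: cube_labels_def True)
    ultimately have "C \<subseteq> {}"
      unfolding C_def by (rule hull_minimal[rotated])
    then show ?thesis
      using c by simp
  next
    case False
    then have "G1 \<noteq> {}"
      using GG1 by blast
    then show ?thesis
      using const_cube_in_pol_closure[of G1 ?\<CC> S c "card S"] G1 c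
      unfolding univ assms(8) by simp
  qed
  let ?T = "composites S G2"
  have T: "?T \<subseteq> cubes C S" "sym_refl_closed S ?T"
    using composites_in_cubes[OF G2] sym_refl_closed_composites[OF G2_closed] .
  have "Theta \<AA> S G \<subseteq> ?T"
    unfolding Theta_def
  proof (rule hull_minimal)
    show "G \<subseteq> ?T"
      using GG1 G1G2 composites.base by blast
    have "?T \<subseteq> cubes (universe \<AA>) S"
      using T(1) cubes_mono[OF C_sub] by (rule order.trans)
    moreover have "closed_under S (arity \<AA> F) (interp \<AA> F) ?T" if F: "F \<in> symbols \<AA>" for F
    proof (rule closed_under_if_closed_on_cells[OF assms(2) T(2) paste_closed_composites])
      fix \<gamma>s assume \<gamma>s: "\<gamma>s \<in> tuples ?T (arity \<AA> F)" "\<forall>i\<in>S. at_most_one_nondegenerate S i \<gamma>s"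
      have "coordinatewise S (interp ?\<CC> F) \<gamma>s \<in> ?T"
      proof (rule coordinatewise_cell[OF alg assms(2,6)])
        show "closed_under S (card S) p ?T" if "p \<in> Pol (card S) ?\<CC>" for p
          by (rule closed_under_composites[OF G2_Pol[OF that] G2_closed])
        show "const_cube S c \<in> ?T" if "c \<in> universe ?\<CC>" for c
          using that unfolding univ by (intro composites.base G2_const)
        show "?T \<subseteq> cubes (universe ?\<CC>) S"
          unfolding univ by (rule T(1))
      qed (use F \<gamma>s in simp_all)
      then show "coordinatewise S (interp \<AA> F) \<gamma>s \<in> ?T"
        by simp
    qed
    ultimately show "dim_congruence \<AA> S ?T"
      using T(2) paste_closed_composites by (simp add: dim_congruence_def dim_equivalence_iff)
  qed
  moreover have "?T \<subseteq> Theta \<AA> S G"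
  proof -
    have "?T \<subseteq> R" if R: "dim_congruence \<AA> S R" "G \<subseteq> R" for R
    proof -
      let ?R = "R \<inter> cubes C S"
      note R' = dim_congruence_Int_cubes[OF R(1) C]
      have GR: "G \<subseteq> ?R"
        using G R(2) by (rule Int_greatest[rotated])
      have sub: "?R \<subseteq> cubes (universe \<AA>) S"
        using cubes_mono[OF C_sub] by blast
      have const: "const_cube S c \<in> ?R" if "c \<in> C" for c
        by (rule const_cubes_in_closed[OF assms(2) GR sub R'(1,3)]) (use that in \<open>simp_all add: C_def\<close>)
      have "G1 \<subseteq> ?R"
        unfolding assms(7) using GR R'(1) by (rule sym_refl_closure_minimal)
      moreover have "closed_under S (card S) p ?R" if "p \<in> Pol (card S) ?\<CC>" for p
      proof (rule closed_under_Pol[OF _ _ _ that])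
        show "closed_under S (arity ?\<CC> F) (interp ?\<CC> F) ?R" if "F \<in> symbols ?\<CC>" for F
          using R'(3) that by simp
        show "?R \<subseteq> cubes (universe ?\<CC>) S"
          unfolding univ by (rule Int_lower2)
        show "const_cube S c \<in> ?R" if "c \<in> universe ?\<CC>" for c
          using that unfolding univ by (rule const)
      qed
      ultimately have "G2 \<subseteq> ?R"
        unfolding assms(8) by (rule pol_closure_minimal)
      from composites_minimal[OF this R'(2)] show ?thesis
        by blast
    qed
    then show ?thesis
      unfolding Theta_def hull_def by blast
  qed
  ultimately show ?thesis
    using TC_eq_composites[OF assms(2,3,6) G2] by simp
qed

end
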